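(* For all integers $k\ge 1$ and $n\ge 0$, we have $\gamma_{2,3,5,5/2,1/2}^k(n)\ge 0$; that is, the coefficient of $q^n$ in $$\frac{1}{(1-q^2)(1-q^3)(1-q^5)}\sum_{j\notin[-k,k-1]}(-1)^{j+k}q^{j(5j+1)/2}$$ is nonnegative.
   Context: Identities are between formal power series in $q$. The sum $\sum_{j\notin[-k,k-1]}$ is over all integers $j\le -k-1$ and all integers $j\ge k$. In general $\gamma_{a,b,c,A,B}^k(n)$ is defined by $\frac{1}{(1-q^a)(1-q^b)(1-q^c)}\sum_{j\notin[-k,k-1]}(-1)^{j+k}q^{Aj^2+Bj}=\sum_{n\ge0}\gamma_{a,b,c,A,B}^k(n)q^n$. *)

theory Defs
  imports
    "HOL-Analysis.Infinite_Sum"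
    "HOL-Computational_Algebra.Formal_Power_Series"
begin

text \<open>
  The infinite sum is taken in the standard topology of formal power series.
  Since \<^const>\<open>fps_X\<close> only has natural powers, the rational exponent \<open>A j\<^sup>2 + B j\<close>
  is converted by \<open>nat \<lfloor>_\<rfloor>\<close>; the definition is meaningful only when these exponents are
  nonnegative integers, so that nothing is rounded, and when the series is summable.
  For \<open>A = 5/2\<close>, \<open>B = 1/2\<close> both are proved below.
\<close>

definition theta_term :: "rat \<Rightarrow> rat \<Rightarrow> int \<Rightarrow> int \<Rightarrow> rat fps" where
  "theta_term A B k j =
     fps_const ((-1) powi (j + k)) * fps_X ^ nat \<lfloor>A * of_int j ^ 2 + B * of_int j\<rfloor>"

definition gamma_fps :: "nat \<Rightarrow> nat \<Rightarrow> nat \<Rightarrow> rat \<Rightarrow> rat \<Rightarrow> int \<Rightarrow> rat fps" where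
  "gamma_fps a b c A B k =
     1 / ((1 - fps_X ^ a) * (1 - fps_X ^ b) * (1 - fps_X ^ c)) *
     (\<Sum>\<^sub>\<infinity>j | j \<notin> {-k..k-1}. theta_term A B k j)"

definition gamma_coeff :: "nat \<Rightarrow> nat \<Rightarrow> nat \<Rightarrow> rat \<Rightarrow> rat \<Rightarrow> int \<Rightarrow> nat \<Rightarrow> rat" where
  "gamma_coeff a b c A B k n = fps_nth (gamma_fps a b c A B k) n"

lemma exponent_5_2_1_2:
  fixes j :: int
  shows "rat_of_nat (nat \<lfloor>5/2 * rat_of_int j ^ 2 + 1/2 * rat_of_int j\<rfloor>) =
           5/2 * rat_of_int j ^ 2 + 1/2 * rat_of_int j"
    and "nat \<lfloor>5/2 * rat_of_int j ^ 2 + 1/2 * rat_of_int j\<rfloor> = nat (j * (5 * j + 1) div 2)"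
    and "\<bar>j\<bar> \<le> j * (5 * j + 1) div 2"
proof -
  have "even (j * (5 * j + 1))" by simp
  then obtain m where m: "j * (5 * j + 1) = 2 * m" by (elim evenE)
  have "rat_of_int (j * (5 * j + 1)) = rat_of_int (2 * m)" using m by (rule arg_cong)
  then have r: "5/2 * rat_of_int j ^ 2 + 1/2 * rat_of_int j = rat_of_int m"
    by (simp add: algebra_simps power2_eq_square)
  have "\<bar>j\<bar> \<le> \<bar>j\<bar> * \<bar>j\<bar>"
    using mult_left_mono[of 1 "\<bar>j\<bar>" "\<bar>j\<bar>"] by (cases "j = 0") auto
  then have "\<bar>j\<bar> \<le> j * j" by simp
  then have j: "\<bar>j\<bar> \<le> m" using m by (simp add: algebra_simps)
  show "\<bar>j\<bar> \<le> j * (5 * j + 1) div 2" using j m by simp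
  show "nat \<lfloor>5/2 * rat_of_int j ^ 2 + 1/2 * rat_of_int j\<rfloor> = nat (j * (5 * j + 1) div 2)"
    unfolding r using m by simp
  show "rat_of_nat (nat \<lfloor>5/2 * rat_of_int j ^ 2 + 1/2 * rat_of_int j\<rfloor>) =
           5/2 * rat_of_int j ^ 2 + 1/2 * rat_of_int j"
    unfolding r using j by simp
qed

lemma has_sum_theta_term_5_2_1_2:
  fixes k :: int and S :: "int set"
  shows "(theta_term (5/2) (1/2) k has_sum
           Abs_fps (\<lambda>m. \<Sum>j | j \<in> S \<and> j * (5 * j + 1) div 2 = int m. (-1) powi (j + k))) S"
  unfolding has_sum_def
proof (rule tendsto_fpsI)
  fix m :: nat
  define T where "T = {j \<in> S. j * (5 * j + 1) div 2 = int m}"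
  have "T \<subseteq> {- int m..int m}"
  proof
    fix j assume "j \<in> T"
    then show "j \<in> {- int m..int m}" using exponent_5_2_1_2(3)[of j] by (auto simp: T_def)
  qed
  then have fin: "finite T" by (rule finite_subset) simp
  have nth: "fps_nth (theta_term (5/2) (1/2) k j) m =
      (if j * (5 * j + 1) div 2 = int m then (-1) powi (j + k) else 0)" for j
    using exponent_5_2_1_2(3)[of j] unfolding theta_term_def exponent_5_2_1_2(2)
    by auto
  show "\<forall>\<^sub>F F in finite_subsets_at_top S.
      fps_nth (sum (theta_term (5/2) (1/2) k) F) m =
      fps_nth (Abs_fps (\<lambda>m. \<Sum>j | j \<in> S \<and> j * (5 * j + 1) div 2 = int m. (-1) powi (j + k))) m"
    unfolding eventually_finite_subsets_at_top
  proof (intro exI[of _ T] conjI allI impI)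
    show "finite T" by (rule fin)
    show "T \<subseteq> S" by (auto simp: T_def)
    fix F assume F: "finite F \<and> T \<subseteq> F \<and> F \<subseteq> S"
    have "fps_nth (sum (theta_term (5/2) (1/2) k) F) m =
        (\<Sum>j\<in>F. if j * (5 * j + 1) div 2 = int m then (-1) powi (j + k) else 0)"
      by (simp add: fps_sum_nth nth)
    also have "\<dots> = (\<Sum>j\<in>T. (-1) powi (j + k))"
      using F by (intro sum.mono_neutral_cong_right) (auto simp: T_def)
    finally show "fps_nth (sum (theta_term (5/2) (1/2) k) F) m =
      fps_nth (Abs_fps (\<lambda>m. \<Sum>j | j \<in> S \<and> j * (5 * j + 1) div 2 = int m. (-1) powi (j + k))) m"
      by (simp add: T_def)
  qed
qed

end

theory Submission
  imports Defs
begin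

text \<open>
  Let \<open>p(m)\<close> be the number of partitions of \<open>m\<close> into parts 2, 3, 5, so that the coefficient is
  \<open>f(k) - f(k+1) + f(k+2) - \<dots>\<close>, where \<open>f(j) = p(n - e(j)) - p(n - e(-1-j))\<close> and
  \<open>e(j) = j(5j+1)/2\<close>. Now \<open>60 p(m)\<close> is \<open>(m+5)\<^sup>2\<close> plus a function of \<open>m mod 30\<close>, also for
  \<open>-9 \<le> m < 0\<close>. The quadratic part of \<open>60 f(j)\<close> equals \<open>S(j) + S(j+1)\<close> for the cubic
  \<open>S(j) = 2j(2n + 13 - 5j\<^sup>2)\<close>, and the periodic part contributes at most 56. If \<open>J\<close> is the largest
  index with \<open>e(J) \<le> n\<close>, telescoping from \<open>k\<close> to \<open>J\<close> shows that 60 times the coefficient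
  differs from \<open>S(k)\<close> by at most \<open>6J\<^sup>2 + 6J + 105 + 56(J - k)\<close>. This is less than \<open>S(k)\<close> unless
  \<open>J \<le> k\<close>, where at most the term \<open>f(k) \<ge> 0\<close> is left, or \<open>k = 1\<close> and \<open>J < 16\<close>, or \<open>k = 2\<close> and
  \<open>J < 5\<close>. The last two cases are finite and are settled by running the linear recurrence of
  the coefficients.
\<close>

section \<open>The exponents of the theta series\<close>

definition pent :: "int \<Rightarrow> int" where
  "pent j = j * (5 * j + 1) div 2"

lemma two_pent: "2 * pent j = j * (5 * j + 1)"
proof -
  have "even (j * (5 * j + 1))" by simp
  then show ?thesis unfolding pent_def by (rule dvd_mult_div_cancel)
qed

lemma abs_le_pent: "\<bar>j\<bar> \<le> pent j"
  unfolding pent_def by (rule exponent_5_2_1_2(3))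

lemma pent_nonneg: "0 \<le> pent j"
  using abs_le_pent[of j] by linarith

lemma pent_strict_mono:
  assumes "0 \<le> i" "i < j" shows "pent i < pent j"
proof -
  have "i * (5 * i + 1) < j * (5 * j + 1)"
    using assms by (intro mult_strict_mono) auto
  then show ?thesis using two_pent[of i] two_pent[of j] by linarith
qed

lemma pent_mono: "0 \<le> i \<Longrightarrow> i \<le> j \<Longrightarrow> pent i \<le> pent j"
  using pent_strict_mono[of i j] by (cases "i = j") auto

lemma pent_add_1: "pent (j + 1) = pent j + 5 * j + 3"
  using two_pent[of "j + 1"] two_pent[of j] by (simp add: algebra_simps)

lemma pent_reflect: "pent (- 1 - j) = pent j + 4 * j + 2"
  using two_pent[of "- 1 - j"] two_pent[of j] by (simp add: algebra_simps)

section \<open>The quasi-polynomial for partitions into parts 2, 3 and 5\<close>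

text \<open>
  By partial fractions the periodic part of \<open>60 p(m)\<close> is a sum of functions of \<open>m mod 2\<close>,
  \<open>m mod 3\<close> and \<open>m mod 5\<close>. The first is kept apart because it cancels in \<open>f(j)\<close>, as
  \<open>e(-1-j) - e(j) = 4j + 2\<close> is even.
\<close>

definition rem2 :: "int \<Rightarrow> int" where "rem2 m = 15 * (m mod 2)"

definition rem35 :: "int \<Rightarrow> int" where
  "rem35 m = (if m mod 3 = 1 then 20 else 0) +
     (if m mod 5 = 0 then 0 else if m mod 5 = 1 \<or> m mod 5 = 4 then 36 else 24)"

definition quasi :: "int \<Rightarrow> int" where
  "quasi m = (m + 5)\<^sup>2 + 35 - rem2 m - rem35 m"

text \<open>This is \<open>60 p(m)\<close>.\<close>

definition parts60 :: "int \<Rightarrow> int" where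
  "parts60 m = (if m < 0 then 0 else quasi m)"

lemma rem2_bounds: "0 \<le> rem2 m" "rem2 m \<le> 15"
  by (auto simp: rem2_def)

lemma rem35_bounds: "0 \<le> rem35 m" "rem35 m \<le> 56"
  by (auto simp: rem35_def)

text \<open>The generating function is rational of degree -10, as 2 + 3 + 5 = 10, so its
  quasi-polynomial vanishes at -1, ..., -9.\<close>

lemma parts60_eq_quasi:
  assumes "- 9 \<le> m" shows "parts60 m = quasi m"
proof (cases "m < 0")
  case True
  with assms have "m \<in> {-9,-8,-7,-6,-5,-4,-3,-2,-1}" by auto
  with True show ?thesis
    by (auto simp: parts60_def quasi_def rem2_def rem35_def)
qed (simp add: parts60_def)

lemma parts60_nonneg: "0 \<le> parts60 m"
proof -
  consider "m < 0" | "m = 0" | "m \<ge> 1" by linarith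
  then show ?thesis
  proof cases
    case 3
    then have "6\<^sup>2 \<le> (m + 5)\<^sup>2" by (intro power_mono) auto
    with 3 show ?thesis
      using rem2_bounds[of m] rem35_bounds[of m] by (simp add: parts60_def quasi_def)
  qed (simp_all add: parts60_def quasi_def rem2_def rem35_def)
qed

text \<open>Read off from (1-q^2)(1-q^3)(1-q^5) = 1 - q^2 - q^3 + q^7 + q^8 - q^10. For m >= 1 no
  argument falls below -9, so \<open>quasi\<close> can stand in throughout.\<close>

lemma parts60_recurrence:
  "parts60 m = parts60 (m - 2) + parts60 (m - 3) - parts60 (m - 7) - parts60 (m - 8)
     + parts60 (m - 10) + 60 * of_bool (m = 0)"
proof -
  consider "m < 0" | "m = 0" | "1 \<le> m" by linarith
  then show ?thesis
  proof cases
    case 3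
    have r2: "rem2 (m - 2) = rem2 m" "rem2 (m - 3) = rem2 (m - 1)" "rem2 (m - 7) = rem2 (m - 1)"
        "rem2 (m - 8) = rem2 m" "rem2 (m - 10) = rem2 m"
      by (simp_all add: rem2_def mod_eq_dvd_iff)
    have r3: "(m - 3) mod 3 = m mod 3" "(m - 7) mod 3 = (m - 1) mod 3"
        "(m - 8) mod 3 = (m - 2) mod 3" "(m - 10) mod 3 = (m - 1) mod 3"
      by (simp_all add: mod_eq_dvd_iff)
    have r5: "(m - 7) mod 5 = (m - 2) mod 5" "(m - 8) mod 5 = (m - 3) mod 5"
        "(m - 10) mod 5 = m mod 5"
      by (simp_all add: mod_eq_dvd_iff)
    have "rem35 m - rem35 (m - 2) - rem35 (m - 3) + rem35 (m - 7) + rem35 (m - 8)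
        - rem35 (m - 10) = 0"
      unfolding rem35_def r3 r5 by simp
    with r2 3 show ?thesis
      by (simp add: parts60_eq_quasi) (simp add: quasi_def power2_eq_square algebra_simps)
  qed (simp_all add: parts60_def quasi_def rem2_def rem35_def)
qed

text \<open>The main term is a difference of squares. The lower bound on m keeps both arguments at
  least -9.\<close>

lemma parts60_diff:
  assumes "4 * j - 7 \<le> m"
    and "0 \<le> j"
  shows "\<bar>parts60 m - parts60 (m - (4 * j + 2)) - (4 * j + 2) * (2 * m + 8 - 4 * j)\<bar> \<le> 56"
proof -
  have "rem2 (m - (4 * j + 2)) = rem2 m"
    by (simp add: rem2_def mod2_eq_if)
  moreover have "parts60 m = quasi m" "parts60 (m - (4 * j + 2)) = quasi (m - (4 * j + 2))"
    using assms by (auto intro!: parts60_eq_quasi)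
  ultimately have "parts60 m - parts60 (m - (4 * j + 2)) - (4 * j + 2) * (2 * m + 8 - 4 * j) =
      rem35 (m - (4 * j + 2)) - rem35 m"
    by (simp add: quasi_def power2_eq_square algebra_simps)
  then show ?thesis
    using rem35_bounds[of m] rem35_bounds[of "m - (4 * j + 2)"] by linarith
qed

lemma fps_parts60:
  "(1 - fps_X ^ 2) * (1 - fps_X ^ 3) * (1 - fps_X ^ 5) *
     Abs_fps (\<lambda>m. of_int (parts60 (int m)) / 60) = (1 :: rat fps)"
    (is "?D * ?F = 1")
proof -
  \<comment> \<open>For m < a this rests on \<open>parts60\<close> being zero at negative
    arguments.\<close>
  have nth: "fps_nth (fps_X ^ a * ?F) m = of_int (parts60 (int m - int a)) / 60" for a m
    by (simp add: fps_X_power_mult_nth of_nat_diff parts60_def)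
  have "?D * ?F = ?F - fps_X ^ 2 * ?F - fps_X ^ 3 * ?F + fps_X ^ 7 * ?F + fps_X ^ 8 * ?F
      - fps_X ^ 10 * ?F"
    by (simp add: algebra_simps flip: power_add mult.assoc)
  moreover have "fps_nth \<dots> m = fps_nth 1 m" for m
  proof -
    have "fps_nth (?F - fps_X ^ 2 * ?F - fps_X ^ 3 * ?F + fps_X ^ 7 * ?F + fps_X ^ 8 * ?F
      - fps_X ^ 10 * ?F) m = of_int (parts60 (int m) - parts60 (int m - 2) - parts60 (int m - 3)
        + parts60 (int m - 7) + parts60 (int m - 8) - parts60 (int m - 10)) / 60"
      by (simp add: nth diff_divide_distrib add_divide_distrib)
    also have "\<dots> = fps_nth 1 m"
      by (subst parts60_recurrence) (simp add: of_bool_def)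
    finally show ?thesis .
  qed
  ultimately show ?thesis by (simp add: fps_eq_iff)
qed

section \<open>Reduction to a finite alternating sum\<close>

definition pair_diff :: "int \<Rightarrow> int \<Rightarrow> int" where
  "pair_diff n j = parts60 (n - pent j) - parts60 (n - pent (- 1 - j))"

lemma pair_diff_eq:
  "pair_diff n j = parts60 (n - pent j) - parts60 (n - pent j - (4 * j + 2))"
  by (simp add: pair_diff_def pent_reflect algebra_simps)

definition alt_sum :: "nat \<Rightarrow> nat \<Rightarrow> int \<Rightarrow> int" where
  "alt_sum k d n = (\<Sum>i\<le>d. (-1) ^ i * pair_diff n (int (k + i)))"

lemma gamma_coeff_eq_sum:
  fixes k d n :: nat
  assumes n: "int n < pent (int (k + d) + 1)"
  shows "gamma_coeff 2 3 5 (5/2) (1/2) (int k) n =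
    of_int (alt_sum k d (int n)) / 60"
proof -
  define S where "S = {j. j \<notin> {- int k..int k - 1}}"
  define T :: "rat fps" where
    "T = Abs_fps (\<lambda>m. \<Sum>j | j \<in> S \<and> j * (5 * j + 1) div 2 = int m. (-1) powi (j + int k))"
  define F :: "rat fps" where "F = Abs_fps (\<lambda>m. of_int (parts60 (int m)) / 60)"
  define h :: "int \<Rightarrow> rat" where
    "h j = (-1) powi (j + int k) * (of_int (parts60 (int n - pent j)) / 60)" for j
  define B where "B = {j \<in> S. pent j \<le> int n}"
  have finB: "finite B"
  proof (rule finite_subset)
    show "B \<subseteq> {- int n..int n}"
    proof
      fix j assume "j \<in> B"
      then show "j \<in> {- int n..int n}" using abs_le_pent[of j] by (auto simp: B_def)
    qed
  qed simp
  have T: "infsum (theta_term (5/2) (1/2) (int k)) S = T"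
    unfolding T_def by (rule infsumI[OF has_sum_theta_term_5_2_1_2])
  have D: "1 / ((1 - fps_X ^ 2) * (1 - fps_X ^ 3) * (1 - fps_X ^ 5)) = F" (is "1 / ?D = F")
  proof -
    have DF: "?D * F = 1" unfolding F_def by (rule fps_parts60)
    then have "?D \<noteq> 0" by (intro notI) simp
    then have "?D * F / ?D = F" by (rule nonzero_mult_div_cancel_left)
    then show ?thesis unfolding DF .
  qed
  have "gamma_coeff 2 3 5 (5/2) (1/2) (int k) n = fps_nth (F * T) n"
    unfolding gamma_coeff_def gamma_fps_def D S_def[symmetric] T ..
  also have "\<dots> = (\<Sum>i\<in>{0..n}. fps_nth F i * fps_nth T (n - i))"
    by (simp add: fps_mult_nth)
  \<comment> \<open>Regroup the convolution by j: the exponent \<open>pent j\<close> meets the index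
    n - \<open>pent j\<close> of \<open>F\<close>.\<close>
  also have "\<dots> = (\<Sum>i\<in>{0..n}. sum h {j \<in> B. n - nat (pent j) = i})"
  proof (rule sum.cong[OF refl])
    fix i assume i: "i \<in> {0..n}"
    have "j \<in> S \<and> pent j = int (n - i) \<longleftrightarrow> j \<in> B \<and> n - nat (pent j) = i" for j
      using i pent_nonneg[of j] by (auto simp: B_def)
    moreover have "pent j = int (n - i) \<Longrightarrow> int n - pent j = int i" for j
      using i by auto
    moreover have "j \<in> B \<Longrightarrow> int (n - nat (pent j)) = int n - pent j" for j
      using pent_nonneg[of j] by (auto simp: B_def of_nat_diff)
    ultimately show "fps_nth F i * fps_nth T (n - i) = sum h {j \<in> B. n - nat (pent j) = i}"
      by (auto simp: F_def T_def h_def sum_distrib_left simp flip: pent_def intro!: sum.cong)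
  qed
  also have "\<dots> = sum h B"
    by (rule sum.group) (auto simp: finB)
  \<comment> \<open>Complete \<open>B\<close> to whole pairs j, -1-j; the added indices have
    exponent above n and contribute zero.\<close>
  also have "\<dots> = sum h ((\<lambda>i. int (k + i)) ` {..d} \<union> (\<lambda>i. - 1 - int (k + i)) ` {..d})"
  proof (rule sum.mono_neutral_left)
    show "B \<subseteq> (\<lambda>i. int (k + i)) ` {..d} \<union> (\<lambda>i. - 1 - int (k + i)) ` {..d}"
    proof
      fix j assume j: "j \<in> B"
      define i where "i = (if 0 \<le> j then nat j else nat (- 1 - j))"
      have "k \<le> i" using j by (auto simp: B_def S_def i_def)
      have "pent (int i) \<le> pent j"
        using pent_reflect[of "int i"] by (auto simp: i_def)
      then have "pent (int i) < pent (int (k + d) + 1)"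
        using j n by (auto simp: B_def)
      then have "i \<le> k + d"
        using pent_mono[of "int (k + d) + 1" "int i"] by linarith
      have "i - k \<in> {..d}" "j = int (k + (i - k)) \<or> j = - 1 - int (k + (i - k))"
        using \<open>k \<le> i\<close> \<open>i \<le> k + d\<close> by (auto simp: i_def)
      then show "j \<in> (\<lambda>i. int (k + i)) ` {..d} \<union> (\<lambda>i. - 1 - int (k + i)) ` {..d}"
        by blast
    qed
    show "\<forall>j\<in>(\<lambda>i. int (k + i)) ` {..d} \<union> (\<lambda>i. - 1 - int (k + i)) ` {..d} - B. h j = 0"
      by (auto simp: B_def S_def h_def parts60_def)
  qed simp
  also have "\<dots> = (\<Sum>i\<le>d. h (int (k + i))) + (\<Sum>i\<le>d. h (- 1 - int (k + i)))"
    by (subst sum.union_disjoint) (auto simp: sum.reindex inj_on_def)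
  also have "\<dots> = (\<Sum>i\<le>d. (-1) ^ i * of_int (pair_diff (int n) (int (k + i))) / 60)"
    unfolding sum.distrib[symmetric]
  proof (rule sum.cong[OF refl])
    fix i
    have "(-1 :: rat) powi (int (k + i) + int k) = (-1) ^ i"
      by (simp add: power_int_add flip: power_add mult_2)
    \<comment> \<open>j and -1-j have opposite parity, which turns each pair into a
      difference.\<close>
    moreover have "(-1 :: rat) powi (- 1 - int (k + i) + int k) = - ((-1) ^ i)"
      by (cases "even i") (simp_all add: power_int_diff power_int_minus)
    ultimately show "h (int (k + i)) + h (- 1 - int (k + i)) =
        (-1) ^ i * of_int (pair_diff (int n) (int (k + i))) / 60"
      unfolding h_def pair_diff_def by (simp add: algebra_simps diff_divide_distrib)
  qed
  finally show ?thesis by (simp add: alt_sum_def sum_divide_distrib)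
qed

section \<open>Telescoping estimate\<close>

text \<open>If the last f were S (k+d) and every other f i were S i + S (i+1), the sum would
  telescope to S k; the deviations add up.\<close>

lemma alternating_sum_approx:
  fixes f S :: "nat \<Rightarrow> 'a :: linordered_idom"
  assumes "\<bar>f (k + d) - S (k + d)\<bar> \<le> h"
    and "\<And>i. k \<le> i \<Longrightarrow> i < k + d \<Longrightarrow> \<bar>f i - (S i + S (Suc i))\<bar> \<le> e"
  shows "\<bar>(\<Sum>i\<le>d. (-1) ^ i * f (k + i)) - S k\<bar> \<le> h + of_nat d * e"
  using assms
proof (induction d arbitrary: k)
  case 0
  then show ?case by simp
next
  case (Suc d)
  have "\<bar>(\<Sum>i\<le>d. (-1) ^ i * f (Suc k + i)) - S (Suc k)\<bar> \<le> h + of_nat d * e"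
    using Suc.prems by (intro Suc.IH) auto
  moreover have "\<bar>f k - (S k + S (Suc k))\<bar> \<le> e"
    using Suc.prems(2)[of k] by simp
  moreover have "(\<Sum>i\<le>Suc d. (-1) ^ i * f (k + i)) = f k - (\<Sum>i\<le>d. (-1) ^ i * f (Suc k + i))"
    by (simp add: sum.atMost_Suc_shift sum_negf del: sum.atMost_Suc)
  ultimately show ?case by (simp add: algebra_simps abs_le_iff)
qed

definition antidiff :: "int \<Rightarrow> int \<Rightarrow> int" where
  "antidiff n j = 2 * j * (2 * n + 13 - 5 * j\<^sup>2)"

lemma antidiff_add:
  "antidiff n j + antidiff n (j + 1) = (4 * j + 2) * (2 * (n - pent j) + 8 - 4 * j)"
proof -
  have "(4 * j + 2) * (2 * (n - pent j) + 8 - 4 * j) =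
      (4 * j + 2) * (2 * n - j * (5 * j + 1) + 8 - 4 * j)"
    using two_pent[of j] by (simp add: algebra_simps)
  then show ?thesis
    by (simp add: antidiff_def power2_eq_square algebra_simps)
qed

lemma pair_diff_approx:
  assumes "0 \<le> j" "4 * j - 7 \<le> n - pent j"
  shows "\<bar>pair_diff n j - (antidiff n j + antidiff n (j + 1))\<bar> \<le> 56"
  unfolding pair_diff_eq antidiff_add using parts60_diff[OF assms(2,1)] .

lemma pair_diff_nonneg:
  assumes "1 \<le> j" shows "0 \<le> pair_diff n j"
proof (cases "n - pent j < 4 * j + 2")
  case True
  then have "parts60 (n - pent j - (4 * j + 2)) = 0" by (simp add: parts60_def)
  then show ?thesis unfolding pair_diff_eq using parts60_nonneg by simp
next
  case False
  \<comment> \<open>The factors are at least 6 and 4j + 12 >= 16, so the main term 96 beats the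
    error 56.\<close>
  have "6 * 16 \<le> (4 * j + 2) * (2 * (n - pent j) + 8 - 4 * j)"
    using assms False by (intro mult_mono) auto
  then show ?thesis
    using parts60_diff[of j "n - pent j"] assms False unfolding pair_diff_eq by linarith
qed

text \<open>Either the second member of the pair still vanishes, or n is so close to
  \<open>pent (j + 1)\<close> that \<open>antidiff n (j + 1)\<close> is small enough to count as
  error.\<close>

lemma pair_diff_last:
  assumes j: "1 \<le> j" and lower: "pent j \<le> n" and upper: "n < pent (j + 1)"
  shows "\<bar>pair_diff n j - antidiff n j\<bar> \<le> 6 * j\<^sup>2 + 6 * j + 105"
proof -
  define y where "y = n - pent j + 5"
  have n2: "2 * n = 2 * y - 10 + j * (5 * j + 1)"
    using two_pent[of j] by (simp add: y_def)
  have "2 * n < (j + 1) * (5 * (j + 1) + 1)"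
    using upper two_pent[of "j + 1"] by linarith
  then have y: "5 \<le> y" "y \<le> 5 * j + 7"
    using lower n2 by (auto simp: y_def algebra_simps)
  show ?thesis
  proof (cases "y \<le> 4 * j + 6")
    case True
    have "parts60 (n - pent j - (4 * j + 2)) = 0"
      using True by (simp add: parts60_def y_def)
    moreover have "parts60 (n - pent j) = y\<^sup>2 + 35 - rem2 (n - pent j) - rem35 (n - pent j)"
      using lower by (simp add: parts60_def quasi_def y_def)
    moreover have "antidiff n j = 4 * j * y + 2 * j\<^sup>2 + 6 * j"
      unfolding antidiff_def n2 by (simp add: algebra_simps power2_eq_square)
    ultimately have eq: "pair_diff n j - antidiff n j =
        y\<^sup>2 - 4 * j * y - 2 * j\<^sup>2 - 6 * j + 35 - rem2 (n - pent j) - rem35 (n - pent j)"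
      unfolding pair_diff_eq by simp
    \<comment> \<open>The factor y + 6 makes the terms linear in y alone cancel.\<close>
    have "0 \<le> (4 * j + 6 - y) * (y + 6)"
      using True y j by (intro mult_nonneg_nonneg) auto
    then have "y\<^sup>2 - 4 * j * y \<le> 24 * j + 36"
      by (simp add: power2_eq_square algebra_simps)
    moreover have "0 \<le> (y - 2 * j)\<^sup>2" by simp
    then have "- 4 * j\<^sup>2 \<le> y\<^sup>2 - 4 * j * y"
      by (simp add: power2_eq_square algebra_simps)
    moreover have "j \<le> j\<^sup>2" using j by (simp add: power2_eq_square)
    moreover have "0 \<le> (j - 1)\<^sup>2" by simp
    then have "2 * j \<le> j\<^sup>2 + 1" by (simp add: power2_eq_square algebra_simps)
    ultimately show ?thesis
      unfolding eq abs_le_iff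
      using rem2_bounds[of "n - pent j"] rem35_bounds[of "n - pent j"] j by linarith
  next
    case False
    have "\<bar>pair_diff n j - (antidiff n j + antidiff n (j + 1))\<bar> \<le> 56"
      using False j by (intro pair_diff_approx) (auto simp: y_def)
    moreover have "\<bar>antidiff n (j + 1)\<bar> \<le> 2 * (j + 1) * (j + 12)"
    proof -
      have "antidiff n (j + 1) = 2 * (j + 1) * (2 * y - 2 - 9 * j)"
        unfolding antidiff_def n2 by (simp add: algebra_simps power2_eq_square)
      moreover have "\<bar>2 * y - 2 - 9 * j\<bar> \<le> j + 12"
        using False y j by linarith
      ultimately show ?thesis using j by (simp add: abs_mult mult_left_mono)
    qed
    \<comment> \<open>This square is exactly the slack in the next bound; it fixes the constant
      105.\<close>
    moreover have "0 \<le> (2 * j - 5)\<^sup>2" by simp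
    then have "2 * (j + 1) * (j + 12) + 56 \<le> 6 * j\<^sup>2 + 6 * j + 105"
      by (simp add: power2_eq_square algebra_simps)
    ultimately show ?thesis by linarith
  qed
qed

lemma alt_sum_nonneg:
  fixes k d :: nat
  assumes k: "1 \<le> k" and d: "1 \<le> d"
    and lower: "pent (int (k + d)) \<le> n" and upper: "n < pent (int (k + d) + 1)"
    and large: "3 \<le> k \<or> (k = 2 \<and> 5 \<le> k + d) \<or> (k = 1 \<and> 16 \<le> k + d)"
  shows "0 \<le> alt_sum k d n"
proof -
  define J where "J = int (k + d)"
  have "\<bar>alt_sum k d n - antidiff n (int k)\<bar> \<le> (6 * J\<^sup>2 + 6 * J + 105) + of_nat d * 56"
    unfolding alt_sum_def
  proof (rule alternating_sum_approx)
    show "\<bar>pair_diff n (int (k + d)) - antidiff n (int (k + d))\<bar> \<le> 6 * J\<^sup>2 + 6 * J + 105"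
      unfolding J_def using k lower upper by (intro pair_diff_last) auto
    fix i assume i: "k \<le> i" "i < k + d"
    have "pent (int i + 1) \<le> n"
      using pent_mono[of "int i + 1" "int (k + d)"] i lower by simp
    then have "\<bar>pair_diff n (int i) - (antidiff n (int i) + antidiff n (int i + 1))\<bar> \<le> 56"
      by (intro pair_diff_approx) (auto simp: pent_add_1)
    then show "\<bar>pair_diff n (int i) - (antidiff n (int i) + antidiff n (int (Suc i)))\<bar> \<le> 56"
      by (simp add: add.commute)
  qed
  moreover have "6 * J\<^sup>2 + 6 * J + 105 + int d * 56 \<le> antidiff n (int k)"
  proof -
    have "J * (5 * J + 1) \<le> 2 * n"
      using lower two_pent[of J] by (simp add: J_def)
    then have "2 * int k * (J * (5 * J + 1) + 13 - 5 * (int k)\<^sup>2) \<le> antidiff n (int k)"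
      unfolding antidiff_def by (intro mult_left_mono) auto
    moreover have "6 * J\<^sup>2 + 6 * J + 105 + int d * 56 \<le>
        2 * int k * (J * (5 * J + 1) + 13 - 5 * (int k)\<^sup>2)"
      \<comment> \<open>After the substitutions the difference of the sides has only positive
        coefficients. For k = 2 and k = 1, the thresholds 5 and 16 are the least k + d satisfying
        the inequality.\<close>
      using large
    proof (elim disjE conjE)
      assume "3 \<le> k"
      then obtain s where s: "k = 3 + s" using le_Suc_ex by blast
      obtain t where t: "d = 1 + t" using d le_Suc_ex by blast
      show ?thesis
        by (simp add: J_def s t power2_eq_square algebra_simps)
    next
      assume "k = 2" "5 \<le> k + d"
      then obtain t where t: "d = 3 + t" using le_Suc_ex[of 3 d] by auto
      show ?thesis
        by (simp add: J_def \<open>k = 2\<close> t power2_eq_square algebra_simps)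
    next
      assume "k = 1" "16 \<le> k + d"
      then obtain t where t: "d = 15 + t" using le_Suc_ex[of 15 d] by auto
      show ?thesis
        by (simp add: J_def \<open>k = 1\<close> t power2_eq_square algebra_simps)
    qed
    ultimately show ?thesis by linarith
  qed
  ultimately show ?thesis by linarith
qed

section \<open>The finite check\<close>

text \<open>
  The coefficients of the numerator, whose product with \<open>1/((1-q\<^sup>2)(1-q\<^sup>3)(1-q\<^sup>5))\<close> has the
  coefficients \<open>alt_sum k d n / 60\<close>.
\<close>

definition source :: "nat \<Rightarrow> nat \<Rightarrow> int \<Rightarrow> int" where
  "source k d n = (\<Sum>i\<le>d. (-1) ^ i *
     (of_bool (n = pent (int (k + i))) - of_bool (n = pent (- 1 - int (k + i)))))"

lemma pair_diff_recurrence: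
  "pair_diff n j = pair_diff (n - 2) j + pair_diff (n - 3) j - pair_diff (n - 7) j
     - pair_diff (n - 8) j + pair_diff (n - 10) j
     + 60 * (of_bool (n = pent j) - of_bool (n = pent (- 1 - j)))"
proof -
  have *: "n - c - pent i = n - pent i - c" for c i by simp
  then show ?thesis
    using parts60_recurrence[of "n - pent j"] parts60_recurrence[of "n - pent (- 1 - j)"]
    unfolding pair_diff_def * by simp
qed

lemma alt_sum_recurrence:
  "alt_sum k d n = alt_sum k d (n - 2) + alt_sum k d (n - 3) - alt_sum k d (n - 7)
     - alt_sum k d (n - 8) + alt_sum k d (n - 10) + 60 * source k d n"
  unfolding alt_sum_def source_def sum_distrib_left sum.distrib[symmetric] sum_subtractf[symmetric]
  by (rule sum.cong[OF refl], subst pair_diff_recurrence) (simp add: algebra_simps)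

lemma alt_sum_eq_0:
  assumes "n < pent (int k)"
  shows "alt_sum k d n = 0"
proof -
  have "n < pent (int k + int i)" "n < pent (- 1 - (int k + int i))" for i
    using assms pent_mono[of "int k" "int k + int i"] pent_reflect[of "int k + int i"] by simp_all
  then show ?thesis by (simp add: alt_sum_def pair_diff_def parts60_def)
qed

text \<open>
  The arguments after the list are the ten most recent values of the recurrence, latest first;
  the list holds the inhomogeneous terms still to come.
\<close>

primrec nonneg_run ::
  "int list \<Rightarrow> int \<Rightarrow> int \<Rightarrow> int \<Rightarrow> int \<Rightarrow> int \<Rightarrow> int \<Rightarrow> int \<Rightarrow> int
    \<Rightarrow> int \<Rightarrow> int \<Rightarrow> bool" where
  "nonneg_run [] a1 a2 a3 a4 a5 a6 a7 a8 a9 a10 = True"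
| "nonneg_run (t # ts) a1 a2 a3 a4 a5 a6 a7 a8 a9 a10 =
     (0 \<le> a2 + a3 - a7 - a8 + a10 + t \<and>
      nonneg_run ts (a2 + a3 - a7 - a8 + a10 + t) a1 a2 a3 a4 a5 a6 a7 a8 a9)"

text \<open>The head of the list and the window yield c m, and the induction slides the window by
  one. A whole range is thus checked by one evaluation.\<close>

lemma nonneg_run_upto:
  assumes "\<And>n. c n = c (n - 2) + c (n - 3) - c (n - 7) - c (n - 8) + c (n - 10) + t n"
  shows "nonneg_run (map t [m..n]) (c (m - 1)) (c (m - 2)) (c (m - 3)) (c (m - 4)) (c (m - 5))
      (c (m - 6)) (c (m - 7)) (c (m - 8)) (c (m - 9)) (c (m - 10)) \<longleftrightarrow> (\<forall>i\<in>{m..n}. 0 \<le> c i)"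
proof (induction m n rule: upto.induct)
  case (1 m n)
  show ?case
  proof (cases "m \<le> n")
    case True
    then have "{m..n} = insert m {m + 1..n}" by auto
    moreover have "nonneg_run (map t [m + 1..n]) (c m) (c (m - 1)) (c (m - 2)) (c (m - 3)) (c (m - 4))
        (c (m - 5)) (c (m - 6)) (c (m - 7)) (c (m - 8)) (c (m - 9)) \<longleftrightarrow> (\<forall>i\<in>{m + 1..n}. 0 \<le> c i)"
      using 1[OF True] by simp
    moreover have "c (m - 2) + c (m - 3) - c (m - 7) - c (m - 8) + c (m - 10) + t m = c m"
      by (rule assms[symmetric])
    ultimately show ?thesis using True by (simp add: upto_rec1)
  qed simp
qed

text \<open>The membership form lets the simplifier evaluate each inhomogeneous term of the
  run.\<close>

lemma source_1: 
  "source 1 14 n =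
     (if n \<in> {3, 21, 24, 60, 65, 119, 126, 198, 207, 297, 308, 416, 429, 555, 570} then 1
      else if n \<in> {9, 11, 38, 42, 87, 93, 156, 164, 245, 255, 354, 366, 483, 497, 632} then - 1
      else 0)"
proof (cases "n \<in> {3, 21, 24, 60, 65, 119, 126, 198, 207, 297, 308, 416, 429, 555, 570} \<union>
    {9, 11, 38, 42, 87, 93, 156, 164, 245, 255, 354, 366, 483, 497, 632}")
  case True
  then show ?thesis
    unfolding Un_iff insert_iff empty_iff
    by (elim disjE)
      (simp_all add: source_def pent_def lessThan_Suc_atMost[symmetric] lessThan_nat_numeral)
next
  case False
  then show ?thesis
    by (simp add: source_def pent_def lessThan_Suc_atMost[symmetric] lessThan_nat_numeral)
qed

lemma source_2:
  "source 2 2 n = (if n \<in> {11, 38, 42} then 1 else if n \<in> {21, 24, 60} then - 1 else 0)"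
proof (cases "n \<in> {11, 38, 42} \<union> {21, 24, 60}")
  case True
  then show ?thesis
    unfolding Un_iff insert_iff empty_iff
    by (elim disjE)
      (simp_all add: source_def pent_def lessThan_Suc_atMost[symmetric] lessThan_nat_numeral)
next
  case False
  then show ?thesis
    by (simp add: source_def pent_def lessThan_Suc_atMost[symmetric] lessThan_nat_numeral)
qed

text \<open>
  The bounds 647 and 64 come from \<open>pent 16 = 648\<close> and \<open>pent 5 = 65\<close>: up to there the pairs
  \<open>j \<le> 15\<close> and \<open>j \<le> 4\<close> make up the whole alternating sum.
\<close>

lemma alt_sum_1_nonneg:
  assumes "n \<le> 647" shows "0 \<le> alt_sum 1 14 n"
proof (cases "n < 3")
  case True
  then show ?thesis using alt_sum_eq_0[of n 1 14] by (simp add: pent_def)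
next
  case False
  \<comment> \<open>Since \<open>pent 1\<close> = 3, the run starts from ten zeros.\<close>
  have "alt_sum 1 14 m = 0" if "m < 3" for m
    using that alt_sum_eq_0[of m 1 14] by (simp add: pent_def)
  moreover have "nonneg_run (map (\<lambda>n. 60 * source 1 14 n) [3..647]) 0 0 0 0 0 0 0 0 0 0"
    by (simp add: source_1 del: One_nat_def)
  ultimately have "\<forall>i\<in>{3..647}. 0 \<le> alt_sum 1 14 i"
    unfolding nonneg_run_upto[of "alt_sum 1 14", OF alt_sum_recurrence, symmetric]
    by (simp del: One_nat_def upto_rec_numeral)
  with assms False show ?thesis by simp
qed

lemma alt_sum_2_nonneg:
  assumes "n \<le> 64" shows "0 \<le> alt_sum 2 2 n"
proof (cases "n < 11")
  case True
  then show ?thesis using alt_sum_eq_0[of n 2 2] by (simp add: pent_def)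
next
  case False
  have "alt_sum 2 2 m = 0" if "m < 11" for m
    using that alt_sum_eq_0[of m 2 2] by (simp add: pent_def)
  moreover have "nonneg_run (map (\<lambda>n. 60 * source 2 2 n) [11..64]) 0 0 0 0 0 0 0 0 0 0"
    by (simp add: source_2)
  ultimately have "\<forall>i\<in>{11..64}. 0 \<le> alt_sum 2 2 i"
    unfolding nonneg_run_upto[of "alt_sum 2 2", OF alt_sum_recurrence, symmetric]
    by (simp del: upto_rec_numeral)
  with assms False show ?thesis by simp
qed

section \<open>Combination of the ranges of k and n\<close>

theorem corollary2p7:
  fixes k :: int and n :: nat
  assumes "k \<ge> 1"
  shows "gamma_coeff 2 3 5 (5/2) (1/2) k n \<ge> 0"
proof -
  obtain K where K: "k = int K" "1 \<le> K"
    using assms by (intro that[of "nat k"]) auto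
  have goal: ?thesis
    if "int n < pent (int (K + d) + 1)" "0 \<le> alt_sum K d (int n)" for d
    unfolding K gamma_coeff_eq_sum[OF that(1)] using that(2) by simp
  consider "K = 1" "n < 648" | "K = 2" "n < 65"
    | "(K = 1 \<longrightarrow> 648 \<le> n) \<and> (K = 2 \<longrightarrow> 65 \<le> n)" by linarith
  then show ?thesis
  proof cases
    case 1
    then show ?thesis
      using alt_sum_1_nonneg[of "int n"] by (intro goal[of 14]) (simp_all add: pent_def)
  next
    case 2
    then show ?thesis
      using alt_sum_2_nonneg[of "int n"] by (intro goal[of 2]) (simp_all add: pent_def)
  next
    case 3
    \<comment> \<open>With d least, K + d is the maximum of K and the J of the overview.\<close>
    define d where "d = (LEAST d. int n < pent (int (K + d) + 1))"
    have "int n < pent (int (K + n) + 1)"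
      using abs_le_pent[of "int (K + n) + 1"] by linarith
    then have upper: "int n < pent (int (K + d) + 1)"
      unfolding d_def by (rule LeastI)
    have "0 \<le> alt_sum K d (int n)"
    proof (cases "d = 0")
      case True
      then show ?thesis using pair_diff_nonneg[of "int K"] K by (simp add: alt_sum_def)
    next
      case False
      then have "\<not> int n < pent (int (K + (d - 1)) + 1)"
        unfolding d_def by (intro not_less_Least) (simp flip: d_def)
      then have lower: "pent (int (K + d)) \<le> int n"
        using False by (simp add: of_nat_diff not_less)
      have J: "m < K + d + 1" if "pent (int m) \<le> int n" for m
        using that upper pent_mono[of "int (K + d) + 1" "int m"] by linarith
      \<comment> \<open>Since \<open>pent 5\<close> = 65 and \<open>pent 16\<close> = 648, the lower
        bounds on n become lower bounds on K + d.\<close>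
      have "3 \<le> K \<or> (K = 2 \<and> 5 \<le> K + d) \<or> (K = 1 \<and> 16 \<le> K + d)"
        using 3 K J[of 5] J[of 16] by (auto simp: pent_def)
      then show ?thesis
        using False K lower upper by (intro alt_sum_nonneg) auto
    qed
    with upper show ?thesis by (rule goal)
  qed
qed

end
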